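(* Let $w_1=(1,0)$, $w_2=(0,1)$, $w_3=(1,1)$, $w_4=(-1,1)$, $w_5=(2,1)$, $w_6=(1,2)$. The system of curves $w_1,\dots,w_6$ on the torus is minimal, i.e. $\mathrm{cr}(6;1)=\mathrm{cr}(w_1,\dots,w_6)=24$.
   Context: Let $\Sigma_1$ be the torus. Isotopy classes of non-contractible, oriented simple closed curves on $\Sigma_1$ correspond bijectively to primitive vectors in $\mathbb{Z}^2$. Only unoriented curves are considered, so $(a,b)$ and $(-a,-b)$ represent the same curve; primitive vectors up to sign are called curves. The geometric intersection number is $i((a,b),(c,d))=|ad-bc|$. A system of $k$ curves consists of $k$ pairwise non-homotopic curves, i.e. primitive vectors $v_1,\dots,v_k\in\mathbb{Z}^2$ with $v_i\ne\pm v_j$ for $i\neq j$. Its crossing number is $\mathrm{cr}(v_1,\dots,v_k)=\sum_{1\le i<j\le k}i(v_i,v_j)$; $\mathrm{cr}(k;1)$ is the minimum of the crossing number over all systems of $k$ curves on the torus, and a system attaining it is called minimal. *)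

theory Defs
  imports Main "HOL-Library.Product_Plus"
begin

text \<open>
  A curve on the torus is an unoriented isotopy class of non-contractible simple closed curves.
  It is represented by its homology class, a primitive vector in \<open>\<int>\<^sup>2\<close>, which is determined
  up to sign.
\<close>

definition primitive :: "int \<times> int \<Rightarrow> bool" where
  "primitive v \<longleftrightarrow> coprime (fst v) (snd v)"

text \<open>The geometric intersection number; it depends only on the vectors up to sign.\<close>

definition intersection_number :: "int \<times> int \<Rightarrow> int \<times> int \<Rightarrow> nat" where
  "intersection_number v w = nat \<bar>fst v * snd w - snd v * fst w\<bar>"

text \<open>
  A system \<open>v\<^sub>1, \<dots>, v\<^sub>k\<close> is a list of length \<open>k\<close>; list positions start at \<open>0\<close>.
\<close>

definition curve_system :: "nat \<Rightarrow> (int \<times> int) list \<Rightarrow> bool" where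
  "curve_system k vs \<longleftrightarrow>
     length vs = k \<and>
     (\<forall>i<k. primitive (vs ! i)) \<and>
     (\<forall>i<k. \<forall>j<k. i \<noteq> j \<longrightarrow> vs ! i \<noteq> vs ! j \<and> vs ! i \<noteq> - (vs ! j))"

definition crossing_number :: "(int \<times> int) list \<Rightarrow> nat" where
  "crossing_number vs = (\<Sum>j<length vs. \<Sum>i<j. intersection_number (vs ! i) (vs ! j))"

text \<open>
  \<open>cr(k;1)\<close>. Systems of \<open>k\<close> curves exist for every \<open>k\<close>, so the minimum is over a nonempty set
  of natural numbers.
\<close>

definition min_crossing_number :: "nat \<Rightarrow> nat" where
  "min_crossing_number k = (LEAST n. \<exists>vs. curve_system k vs \<and> crossing_number vs = n)"

definition minimal_system :: "nat \<Rightarrow> (int \<times> int) list \<Rightarrow> bool" where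
  "minimal_system k vs \<longleftrightarrow> curve_system k vs \<and> crossing_number vs = min_crossing_number k"

end

theory Submission
  imports Defs
begin

text \<open>
  Colour a curve by its parity class in \<open>(\<int>/2)\<^sup>2 - {0}\<close>; there are three colours, and two curves
  have the same colour iff their intersection number is even. Hence two curves of the same colour
  meet at least twice. Three curves of the same colour cannot all meet exactly twice, since the
  relation \<open>det(v,w) u + det(w,u) v + det(u,v) w = 0\<close> would make a sum of three congruent
  nonzero classes vanish modulo 2; so they contribute at least 8. For \<open>x, x'\<close> of one colour and
  \<open>y, y'\<close> of another, the Pluecker relation
  \<open>det(x,x') det(y,y') = det(x,y) det(x',y') - det(x,y') det(x',y)\<close> has a left-hand side of absolute
  value at least 4, so the four (odd) mixed intersection numbers are not all 1, and add up to at
  least 6. Adding up these bounds gives at least 24 for every distribution of six curves among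
  the three colours.
\<close>

section \<open>Intersection numbers and parity\<close>

text \<open>Signed form of \<open>intersection_number\<close>: the linear and Pluecker relations
  used below hold only with signs.\<close>

definition det2 :: "int \<times> int \<Rightarrow> int \<times> int \<Rightarrow> int" where
  "det2 v w = fst v * snd w - snd v * fst w"

lemma int_intersection_number: "int (intersection_number v w) = \<bar>det2 v w\<bar>"
  by (simp add: intersection_number_def det2_def)

lemma intersection_number_commute: "intersection_number v w = intersection_number w v"
  unfolding intersection_number_def by (simp add: abs_minus_commute mult.commute)

lemma intersection_number_self [simp]: "intersection_number v v = 0"
  by (simp add: intersection_number_def)

text \<open>By Euclid's lemma, \<open>a * d = b * c\<close> with coprime entries makes corresponding
  coordinates divide each other, so they agree up to sign; the same equation ties the two signs
  together.\<close>

lemma primitive_det2_eq_0: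
  assumes "primitive v" "primitive w" "det2 v w = 0"
  shows "v = w \<or> v = - w"
proof -
  obtain a b c d where v: "v = (a, b)" and w: "w = (c, d)"
    by (metis surj_pair)
  have ab: "coprime a b" and cd: "coprime c d" and e: "a * d = b * c"
    using assms by (auto simp: v w primitive_def det2_def)
  have "a dvd b * c" "c dvd a * d" "b dvd a * d" "d dvd b * c"
    using e dvd_triv_left[of a d] dvd_triv_right[of d a] by simp_all
  then have "a dvd c" "c dvd a" "b dvd d" "d dvd b"
    using ab cd
    by (simp_all add: coprime_dvd_mult_left_iff coprime_dvd_mult_right_iff coprime_commute)
  then have "\<bar>a\<bar> = \<bar>c\<bar>" "\<bar>b\<bar> = \<bar>d\<bar>"
    by (auto intro: zdvd_antisym_abs)
  then have "a = c \<or> a = - c" "b = d \<or> b = - d"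
    by linarith+
  then show ?thesis
    using e by (auto simp: v w)
qed

definition parity_class :: "int \<times> int \<Rightarrow> bool \<times> bool" where
  "parity_class v = (odd (fst v), odd (snd v))"

lemma primitive_parity_class:
  assumes "primitive v"
  shows "parity_class v \<in> {(True, False), (False, True), (True, True)}"
proof -
  have "\<not> (even (fst v) \<and> even (snd v))"
    using assms unfolding primitive_def by (metis coprime_common_divisor odd_one)
  then show ?thesis by (auto simp: parity_class_def)
qed

text \<open>Over the field with two elements, two nonzero vectors are linearly dependent only if
  they are equal.\<close>

lemma even_intersection_number_iff:
  assumes "primitive v" "primitive w"
  shows "even (intersection_number v w) \<longleftrightarrow> parity_class v = parity_class w"
proof -
  have "even (intersection_number v w) \<longleftrightarrow> even (det2 v w)"
    by (metis dvd_abs_iff even_of_nat int_intersection_number)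
  then show ?thesis
    using primitive_parity_class[OF assms(1)] primitive_parity_class[OF assms(2)]
    by (auto simp: det2_def parity_class_def)
qed

lemma intersection_triple:
  assumes "primitive u" "primitive v" "primitive w"
    and "parity_class u = parity_class v" "parity_class v = parity_class w"
    and "0 < intersection_number u v" "0 < intersection_number v w" "0 < intersection_number u w"
  shows "8 \<le> intersection_number u v + intersection_number v w + intersection_number u w"
proof (rule ccontr)
  assume less: "\<not> ?thesis"
  have "even (intersection_number u v)" "even (intersection_number v w)"
    "even (intersection_number u w)"
    using assms by (simp_all add: even_intersection_number_iff)
  \<comment> \<open>Three positive even numbers with sum below 8 must all be 2.\<close>
  then have "intersection_number u v = 2" "intersection_number v w = 2" "intersection_number u w = 2"
    using less assms(6-8) by presburger+
  then have "\<bar>det2 u v\<bar> = 2" "\<bar>det2 v w\<bar> = 2" "\<bar>det2 u w\<bar> = 2"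
    by (simp_all flip: int_intersection_number)
  then have signs: "det2 u v = 2 \<or> det2 u v = - 2" "det2 v w = 2 \<or> det2 v w = - 2"
    "det2 u w = 2 \<or> det2 u w = - 2"
    by linarith+
  have fst: "det2 v w * fst u - det2 u w * fst v + det2 u v * fst w = 0"
    and snd: "det2 v w * snd u - det2 u w * snd v + det2 u v * snd w = 0"
    by (simp_all add: det2_def algebra_simps)
  \<comment> \<open>All coefficients are 2 or -2. After halving, the relation is a signed sum equal
    to 0, and signs do not matter modulo 2.\<close>
  have "even (fst u + fst v + fst w)"
    using signs fst by (elim disjE; simp; presburger)
  moreover have "even (snd u + snd v + snd w)"
    using signs snd by (elim disjE; simp; presburger)
  \<comment> \<open>Three vectors of one class sum to that class modulo 2, which is nonzero by
    primitivity.\<close>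
  ultimately show False
    using assms(4,5) primitive_parity_class[OF assms(1)] by (auto simp: parity_class_def)
qed

lemma intersection_quadruple:
  assumes "primitive x" "primitive x'" "primitive y" "primitive y'"
    and "parity_class x = parity_class x'" "parity_class y = parity_class y'"
    and "parity_class x \<noteq> parity_class y"
    and "0 < intersection_number x x'" "0 < intersection_number y y'"
  shows "6 \<le> intersection_number x y + intersection_number x y' +
    intersection_number x' y + intersection_number x' y'"
proof (rule ccontr)
  assume less: "\<not> ?thesis"
  have "odd (intersection_number x y)" "odd (intersection_number x y')"
    "odd (intersection_number x' y)" "odd (intersection_number x' y')"
    using assms by (simp_all add: even_intersection_number_iff)
  \<comment> \<open>If one of four odd numbers were at least 3, the sum would reach 6.\<close>
  then have "intersection_number x y = 1" "intersection_number x y' = 1"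
    "intersection_number x' y = 1" "intersection_number x' y' = 1"
    using less by presburger+
  then have ones: "\<bar>det2 x y\<bar> = 1" "\<bar>det2 x y'\<bar> = 1" "\<bar>det2 x' y\<bar> = 1" "\<bar>det2 x' y'\<bar> = 1"
    by (simp_all flip: int_intersection_number)
  have "even (intersection_number x x')" "even (intersection_number y y')"
    using assms by (simp_all add: even_intersection_number_iff)
  then have "2 \<le> intersection_number x x'" "2 \<le> intersection_number y y'"
    using assms(8,9) by presburger+
  then have "2 \<le> \<bar>det2 x x'\<bar>" "2 \<le> \<bar>det2 y y'\<bar>"
    by (simp_all flip: int_intersection_number)
  then have "2 * 2 \<le> \<bar>det2 x x'\<bar> * \<bar>det2 y y'\<bar>"
    by (intro mult_mono) auto
  \<comment> \<open>The Pluecker relation; with all mixed determinants of absolute value 1 it would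
    give 4 \<le> 2.\<close>
  also have "\<dots> = \<bar>det2 x y * det2 x' y' - det2 x y' * det2 x' y\<bar>"
    by (simp add: det2_def algebra_simps flip: abs_mult)
  also have "\<dots> \<le> \<bar>det2 x y\<bar> * \<bar>det2 x' y'\<bar> + \<bar>det2 x y'\<bar> * \<bar>det2 x' y\<bar>"
    by (metis abs_mult abs_triangle_ineq4)
  finally show False using ones by simp
qed

section \<open>Crossing sums of sets of curves\<close>

text \<open>The sum runs over ordered pairs, so \<open>crossing_sum A A\<close> counts every
  crossing of \<open>A\<close> twice. All bounds for it are doubled accordingly.\<close>

definition crossing_sum :: "(int \<times> int) set \<Rightarrow> (int \<times> int) set \<Rightarrow> nat" where
  "crossing_sum A B = (\<Sum>x\<in>A. \<Sum>y\<in>B. intersection_number x y)"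

lemma crossing_sum_commute: "crossing_sum A B = crossing_sum B A"
  unfolding crossing_sum_def by (subst sum.swap) (simp add: intersection_number_commute)

lemma crossing_sum_Un_left:
  assumes "finite A" "finite B" "A \<inter> B = {}"
  shows "crossing_sum (A \<union> B) C = crossing_sum A C + crossing_sum B C"
  unfolding crossing_sum_def using assms by (rule sum.union_disjoint)

lemma crossing_sum_Un_right:
  assumes "finite A" "finite B" "A \<inter> B = {}"
  shows "crossing_sum C (A \<union> B) = crossing_sum C A + crossing_sum C B"
  using assms by (simp add: crossing_sum_commute[of C] crossing_sum_Un_left)

text \<open>The excess of \<open>f\<close> over the constant bound \<open>c\<close> on
  \<open>Q\<close> persists on \<open>P\<close>, since the other terms are at least
  \<open>c\<close>. The additive form avoids truncated subtraction.\<close>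

lemma sum_ge_sum_subset_plus_card:
  fixes f :: "'a \<Rightarrow> nat"
  assumes "finite P" "Q \<subseteq> P" "\<And>p. p \<in> P \<Longrightarrow> c \<le> f p"
  shows "c * card P + sum f Q \<le> sum f P + c * card Q"
proof -
  have "finite Q" using assms(1,2) finite_subset by blast
  have "c * card (P - Q) \<le> sum f (P - Q)"
    using sum_bounded_below[of "P - Q" c f] assms(3) by (simp add: mult.commute)
  moreover have "sum f P = sum f (P - Q) + sum f Q"
    using assms(1,2) by (simp add: sum.subset_diff)
  moreover have "card P = card (P - Q) + card Q"
    using assms(1,2) \<open>finite Q\<close> by (simp add: card_Diff_subset card_mono)
  ultimately show ?thesis by (simp add: algebra_simps)
qed

section \<open>Crossings within one parity class\<close>

context
  fixes A :: "(int \<times> int) set"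
  assumes fin: "finite A"
    and prim: "\<And>x. x \<in> A \<Longrightarrow> primitive x"
    and meet: "pairwise (\<lambda>x y. 0 < intersection_number x y) A"
    and parity: "\<And>x y. x \<in> A \<Longrightarrow> y \<in> A \<Longrightarrow> parity_class x = parity_class y"
begin

lemma intersection_same_class_ge_2:
  assumes "x \<in> A" "y \<in> A" "x \<noteq> y"
  shows "2 \<le> intersection_number x y"
proof -
  have "even (intersection_number x y)"
    using assms(1,2)[THEN prim] parity[OF assms(1,2)] by (simp add: even_intersection_number_iff)
  moreover have "0 < intersection_number x y"
    using assms by (rule meet[THEN pairwiseD(1)])
  ultimately show ?thesis by presburger
qed

lemma intersection_triple_in:
  assumes "x \<in> A" "y \<in> A" "z \<in> A" "x \<noteq> y" "y \<noteq> z" "x \<noteq> z"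
  shows "8 \<le> intersection_number x y + intersection_number y z + intersection_number x z"
  by (rule intersection_triple)
    (rule prim parity pairwiseD(1)[OF meet], rule assms, (rule assms)?, (rule assms)?)+

lemma crossing_sum_self_subset:
  assumes "B \<subseteq> A"
  shows "2 * (card A * (card A - 1)) + crossing_sum B B
    \<le> crossing_sum A A + 2 * (card B * (card B - 1))"
proof -
  let ?P = "\<lambda>A. SIGMA x:A. A - {x}"
  let ?f = "\<lambda>(x, y). intersection_number x y"
  have "finite B" using assms fin by (rule finite_subset)
  have "2 * card (?P A) + sum ?f (?P B) \<le> sum ?f (?P A) + 2 * card (?P B)"
  proof (rule sum_ge_sum_subset_plus_card)
    show "finite (?P A)" using fin by simp
    show "?P B \<subseteq> ?P A" using assms by blast
    show "2 \<le> ?f p" if "p \<in> ?P A" for p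
      using that intersection_same_class_ge_2[of "fst p" "snd p"] by (cases p) auto
  qed
  moreover have "card (?P C) = card C * (card C - 1)" if "finite C" for C :: "(int \<times> int) set"
    using that by simp
  \<comment> \<open>Leaving out the diagonal loses nothing, as a curve has intersection number 0
    with itself.\<close>
  moreover have "crossing_sum C C = sum ?f (?P C)" if "finite C" for C
    using that by (simp add: crossing_sum_def sum.remove flip: sum.Sigma)
  ultimately show ?thesis
    using fin \<open>finite B\<close> by simp
qed

lemma crossing_sum_self_ge: "2 * (card A * (card A - 1)) \<le> crossing_sum A A"
  using crossing_sum_self_subset[of "{}"] by (simp add: crossing_sum_def)

text \<open>A triple contributes at least 2 * 8 = 16 instead of the baseline 12, and this excess
  carries over to all of \<open>A\<close>.\<close>

lemma crossing_sum_self_ge_3: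
  assumes "3 \<le> card A"
  shows "2 * (card A * (card A - 1)) + 4 \<le> crossing_sum A A"
proof -
  obtain B where B: "B \<subseteq> A" "card B = 3"
    using obtain_subset_with_card_n[OF assms] by metis
  then obtain x y z where xyz: "B = {x, y, z}" "x \<noteq> y" "y \<noteq> z" "x \<noteq> z"
    by (auto simp: card_3_iff)
  have "crossing_sum B B =
      2 * (intersection_number x y + intersection_number y z + intersection_number x z)"
    using xyz by (simp add: crossing_sum_def intersection_number_commute)
  moreover have "8 \<le> intersection_number x y + intersection_number y z + intersection_number x z"
    using B xyz by (intro intersection_triple_in) auto
  ultimately show ?thesis
    using crossing_sum_self_subset[OF B(1)] B(2) by simp
qed

text \<open>Each of the six pairs among four curves lies in two of the four triples, so the pairs
  add up to at least 4 * 8 / 2 = 16. Doubled, this exceeds the baseline 24 by 8. The gain settles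
  class sizes 4, 1, 1, where the triple bound would give only 46 out of 48.\<close>

lemma crossing_sum_self_ge_4:
  assumes "4 \<le> card A"
  shows "2 * (card A * (card A - 1)) + 8 \<le> crossing_sum A A"
proof -
  obtain B where B: "B \<subseteq> A" "card B = 4"
    using obtain_subset_with_card_n[OF assms] by metis
  then obtain w C where C: "B = insert w C" "w \<notin> C" "card C = 3"
    using card_Suc_eq[of B 3] by auto
  then obtain x y z where "C = {x, y, z}" "x \<noteq> y" "y \<noteq> z" "x \<noteq> z"
    unfolding card_3_iff by blast
  with C have wxyz: "B = {w, x, y, z}"
    "w \<noteq> x" "w \<noteq> y" "w \<noteq> z" "x \<noteq> y" "y \<noteq> z" "x \<noteq> z"
    by auto
  have "crossing_sum B B =
      2 * (intersection_number w x + intersection_number w y + intersection_number w z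
        + intersection_number x y + intersection_number y z + intersection_number x z)"
    using wxyz by (simp add: crossing_sum_def intersection_number_commute)
  moreover have
    "8 \<le> intersection_number x y + intersection_number y z + intersection_number x z"
    "8 \<le> intersection_number w y + intersection_number y z + intersection_number w z"
    "8 \<le> intersection_number w x + intersection_number x z + intersection_number w z"
    "8 \<le> intersection_number w x + intersection_number x y + intersection_number w y"
    using B wxyz by (auto intro!: intersection_triple_in)
  ultimately show ?thesis
    using crossing_sum_self_subset[OF B(1)] B(2) by simp
qed

end

section \<open>Crossings between two parity classes\<close>

context
  fixes A B :: "(int \<times> int) set"
  assumes fin: "finite A" "finite B"
    and prim: "\<And>x. x \<in> A \<Longrightarrow> primitive x" "\<And>x. x \<in> B \<Longrightarrow> primitive x"
    and meet: "pairwise (\<lambda>x y. 0 < intersection_number x y) A"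
      "pairwise (\<lambda>x y. 0 < intersection_number x y) B"
    and parity: "\<And>x y. x \<in> A \<Longrightarrow> y \<in> A \<Longrightarrow> parity_class x = parity_class y"
      "\<And>x y. x \<in> B \<Longrightarrow> y \<in> B \<Longrightarrow> parity_class x = parity_class y"
      "\<And>x y. x \<in> A \<Longrightarrow> y \<in> B \<Longrightarrow> parity_class x \<noteq> parity_class y"
begin

lemma crossing_sum_subsets:
  assumes "A' \<subseteq> A" "B' \<subseteq> B"
  shows "card A * card B + crossing_sum A' B' \<le> crossing_sum A B + card A' * card B'"
proof -
  have mixed: "1 \<le> intersection_number x y" if "x \<in> A" "y \<in> B" for x y
  proof -
    have "odd (intersection_number x y)"
      using that prim parity(3) by (simp add: even_intersection_number_iff)
    then show ?thesis by presburger
  qed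
  have "1 * card (A \<times> B) + (\<Sum>(x, y)\<in>A' \<times> B'. intersection_number x y)
      \<le> (\<Sum>(x, y)\<in>A \<times> B. intersection_number x y) + 1 * card (A' \<times> B')"
  proof (rule sum_ge_sum_subset_plus_card)
    show "finite (A \<times> B)" using fin by simp
    show "A' \<times> B' \<subseteq> A \<times> B" using assms by blast
    show "1 \<le> (case p of (x, y) \<Rightarrow> intersection_number x y)" if "p \<in> A \<times> B" for p
      using that mixed[of "fst p" "snd p"] by (cases p) auto
  qed
  then show ?thesis
    by (simp add: crossing_sum_def sum.cartesian_product card_cartesian_product)
qed

lemma crossing_sum_ge: "card A * card B \<le> crossing_sum A B"
  using crossing_sum_subsets[of "{}" "{}"] by (simp add: crossing_sum_def)

lemma intersection_quadruple_in:
  assumes "x \<in> A" "x' \<in> A" "x \<noteq> x'" "y \<in> B" "y' \<in> B" "y \<noteq> y'"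
  shows "6 \<le> intersection_number x y + intersection_number x y' +
    intersection_number x' y + intersection_number x' y'"
  by (rule intersection_quadruple[OF prim(1,1,2,2) parity])
    (rule assms pairwiseD(1)[OF meet(1)] pairwiseD(1)[OF meet(2)])+

lemma crossing_sum_ge_2_2:
  assumes "2 \<le> card A" "2 \<le> card B"
  shows "card A * card B + 2 \<le> crossing_sum A B"
proof -
  obtain A' where A': "A' \<subseteq> A" "card A' = 2"
    using obtain_subset_with_card_n[OF assms(1)] by metis
  obtain B' where B': "B' \<subseteq> B" "card B' = 2"
    using obtain_subset_with_card_n[OF assms(2)] by metis
  obtain x x' y y' where *: "A' = {x, x'}" "x \<noteq> x'" "B' = {y, y'}" "y \<noteq> y'"
    using A'(2) B'(2) unfolding card_2_iff by blast
  then have "6 \<le> intersection_number x y + intersection_number x y' +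
    intersection_number x' y + intersection_number x' y'"
    using A' B' by (intro intersection_quadruple_in) auto
  moreover have "crossing_sum A' B' = intersection_number x y + intersection_number x y' +
      (intersection_number x' y + intersection_number x' y')"
    using * by (simp add: crossing_sum_def)
  moreover have "card A' * card B' = 4"
    by (simp add: A' B')
  ultimately show ?thesis
    using crossing_sum_subsets[OF A'(1) B'(1)] by linarith
qed

text \<open>Each of three curves in \<open>A\<close> lies in two of the three pairs, so averaging
  the quadruple bound gives 3 * 6 / 2 = 9 against the baseline 6. Class sizes 3, 2, 1 require this:
  an excess of 2 would give only 46 out of 48.\<close>

lemma crossing_sum_ge_3_2:
  assumes "3 \<le> card A" "2 \<le> card B"
  shows "card A * card B + 3 \<le> crossing_sum A B"
proof -
  obtain A' where A': "A' \<subseteq> A" "card A' = 3"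
    using obtain_subset_with_card_n[OF assms(1)] by metis
  obtain B' where B': "B' \<subseteq> B" "card B' = 2"
    using obtain_subset_with_card_n[OF assms(2)] by metis
  obtain x x' x'' where x: "A' = {x, x', x''}" "x \<noteq> x'" "x \<noteq> x''" "x' \<noteq> x''"
    using A'(2) unfolding card_3_iff by blast
  obtain y y' where y: "B' = {y, y'}" "y \<noteq> y'"
    using B'(2) unfolding card_2_iff by blast
  have
    "6 \<le> intersection_number x y + intersection_number x y' +
      intersection_number x' y + intersection_number x' y'"
    "6 \<le> intersection_number x y + intersection_number x y' +
      intersection_number x'' y + intersection_number x'' y'"
    "6 \<le> intersection_number x' y + intersection_number x' y' +
      intersection_number x'' y + intersection_number x'' y'"
    using A'(1) B'(1) x y intersection_quadruple_in[of x x' y y']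
      intersection_quadruple_in[of x x'' y y'] intersection_quadruple_in[of x' x'' y y']
    by simp_all
  moreover have "crossing_sum A' B' = intersection_number x y + intersection_number x y' +
      (intersection_number x' y + intersection_number x' y' +
      (intersection_number x'' y + intersection_number x'' y'))"
    using x y by (simp add: crossing_sum_def)
  moreover have "card A' * card B' = 6"
    by (simp add: A' B')
  ultimately show ?thesis
    using crossing_sum_subsets[OF A'(1) B'(1)] by linarith
qed

end

section \<open>Distribution of six curves among the three classes\<close>

lemma crossing_sum_ge_48:
  assumes card: "card V = 6"
    and prim: "\<And>x. x \<in> V \<Longrightarrow> primitive x"
    and meet: "pairwise (\<lambda>x y. 0 < intersection_number x y) V"
  shows "48 \<le> crossing_sum V V"
proof -
  define cls where "cls c = {x \<in> V. parity_class x = c}" for c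
  let ?A = "cls (True, False)" and ?B = "cls (False, True)" and ?C = "cls (True, True)"
  have fin: "finite (cls c)" for c
    using card unfolding cls_def by (intro finite_Collect_conjI) (auto intro: card_ge_0_finite)
  have V: "V = ?A \<union> ?B \<union> ?C"
    using primitive_parity_class[OF prim] by (auto simp: cls_def)
  have disj: "cls c \<inter> cls d = {}" if "c \<noteq> d" for c d
    using that by (auto simp: cls_def)
  have meet': "pairwise (\<lambda>x y. 0 < intersection_number x y) (cls c)" for c
    using meet by (rule pairwise_subset) (auto simp: cls_def)
  have prim': "primitive x" if "x \<in> cls c" for x c
    using that prim by (auto simp: cls_def)
  have same: "parity_class x = parity_class y" if "x \<in> cls c" "y \<in> cls c" for x y c
    using that by (auto simp: cls_def)
  have differ: "parity_class x \<noteq> parity_class y" if "c \<noteq> d" "x \<in> cls c" "y \<in> cls d" for x y c d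
    using that by (auto simp: cls_def)
  have self_1: "2 * (card (cls c) * (card (cls c) - 1)) \<le> crossing_sum (cls c) (cls c)"
    for c
    by (rule crossing_sum_self_ge[OF fin prim' meet' same])
  have self_3: "2 * (card (cls c) * (card (cls c) - 1)) + 4 \<le> crossing_sum (cls c) (cls c)"
    if "3 \<le> card (cls c)" for c
    by (rule crossing_sum_self_ge_3[OF fin prim' meet' same that])
  have self_4: "2 * (card (cls c) * (card (cls c) - 1)) + 8 \<le> crossing_sum (cls c) (cls c)"
    if "4 \<le> card (cls c)" for c
    by (rule crossing_sum_self_ge_4[OF fin prim' meet' same that])
  have mixed_1: "card (cls c) * card (cls d) \<le> crossing_sum (cls c) (cls d)"
    if "c \<noteq> d" for c d
    by (rule crossing_sum_ge[OF fin fin prim' prim' meet' meet' same same differ[OF that(1)]])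
  have mixed_2_2: "card (cls c) * card (cls d) + 2 \<le> crossing_sum (cls c) (cls d)"
    if "c \<noteq> d" "2 \<le> card (cls c)" "2 \<le> card (cls d)" for c d
    by (rule crossing_sum_ge_2_2[OF fin fin prim' prim' meet' meet' same same differ[OF that(1)] that(2,3)])
  have mixed_3_2: "card (cls c) * card (cls d) + 3 \<le> crossing_sum (cls c) (cls d)"
    if "c \<noteq> d" "3 \<le> card (cls c)" "2 \<le> card (cls d)" for c d
    by (rule crossing_sum_ge_3_2[OF fin fin prim' prim' meet' meet' same same differ[OF that(1)] that(2,3)])
  have mixed_2_3: "card (cls c) * card (cls d) + 3 \<le> crossing_sum (cls c) (cls d)"
    if "c \<noteq> d" "2 \<le> card (cls c)" "3 \<le> card (cls d)" for c d
    using mixed_3_2[of d c] that by (simp add: crossing_sum_commute mult.commute)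
  note self = self_1 self_3 self_4
  note mixed = mixed_1 mixed_2_2 mixed_3_2 mixed_2_3
  define a b c where "a = card ?A" and "b = card ?B" and "c = card ?C"
  have "card V = a + b + c"
    using fin disj by (subst V) (simp add: card_Un_disjoint Int_Un_distrib2 a_def b_def c_def)
  then have abc: "a + b + c = 6" using card by simp
  have split: "crossing_sum V V = crossing_sum ?A ?A + crossing_sum ?B ?B + crossing_sum ?C ?C
      + 2 * (crossing_sum ?A ?B + crossing_sum ?A ?C + crossing_sum ?B ?C)"
    using fin disj
    by (subst (1 2) V) (simp add: crossing_sum_Un_left crossing_sum_Un_right Int_Un_distrib2
        crossing_sum_commute)
  note bounds = self[of "(True, False)"] self[of "(False, True)"] self[of "(True, True)"]
    mixed[of "(True, False)" "(False, True)"] mixed[of "(True, False)" "(True, True)"]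
    mixed[of "(False, True)" "(True, True)"]
  note bounds' = bounds[folded a_def b_def c_def, simplified]
  have "a \<le> 6" "b \<le> 6" and c: "c = 6 - a - b" using abc by auto
  then have "a \<in> {0, 1, 2, 3, 4, 5, 6}" "b \<in> {0, 1, 2, 3, 4, 5, 6}" by auto
  \<comment> \<open>A finite check over \<open>a\<close> and \<open>b\<close>; pairs with
    \<open>a + b > 6\<close>, where the subtraction in \<open>c\<close> truncates, contradict
    \<open>abc\<close>. The bounds give exactly 48 for class sizes 2, 2, 2 and 3, 2, 1.\<close>
  then show ?thesis
    using bounds' abc unfolding split c by (elim insertE emptyE; simp)
qed

section \<open>Crossing numbers of systems\<close>

lemma sum_symmetric_eq_twice:
  fixes f :: "nat \<Rightarrow> nat \<Rightarrow> 'a::comm_semiring_1"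
  assumes "\<And>i j. f i j = f j i" "\<And>i. f i i = 0"
  shows "(\<Sum>j<n. \<Sum>i<n. f i j) = 2 * (\<Sum>j<n. \<Sum>i<j. f i j)"
proof (induction n)
  case (Suc n)
  have "(\<Sum>j<n. f n j) = (\<Sum>i<n. f i n)"
    using assms(1) by (intro sum.cong) auto
  then show ?case
    using Suc by (simp add: sum.distrib assms(2) algebra_simps mult_2)
qed simp

text \<open>Distinctness makes indexing a bijection onto the set; symmetry and the zero diagonal
  then account for the factor 2.\<close>

lemma crossing_sum_set:
  assumes "distinct vs"
  shows "crossing_sum (set vs) (set vs) = 2 * crossing_number vs"
proof -
  have bij: "bij_betw ((!) vs) {..<length vs} (set vs)"
    using assms by (rule bij_betw_nth) auto
  have "crossing_sum (set vs) (set vs)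
      = (\<Sum>j<length vs. \<Sum>i<length vs. intersection_number (vs ! i) (vs ! j))"
    unfolding crossing_sum_def
    by (subst sum.swap) (simp add: sum.reindex_bij_betw[OF bij, symmetric])
  also have "\<dots> = 2 * crossing_number vs"
    unfolding crossing_number_def
    by (rule sum_symmetric_eq_twice) (auto simp: intersection_number_commute)
  finally show ?thesis .
qed

text \<open>Curves distinct up to sign have nonzero determinant by
  \<open>primitive_det2_eq_0\<close>, so the bound 48 on ordered pairs applies and is
  halved.\<close>

lemma crossing_number_6_ge_24:
  assumes "curve_system 6 vs"
  shows "24 \<le> crossing_number vs"
proof -
  have len: "length vs = 6" and prim: "\<And>x. x \<in> set vs \<Longrightarrow> primitive x"
    and ne: "\<And>i j. i < 6 \<Longrightarrow> j < 6 \<Longrightarrow> i \<noteq> j \<Longrightarrow> vs ! i \<noteq> vs ! j \<and> vs ! i \<noteq> - (vs ! j)"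
    using assms by (auto simp: curve_system_def in_set_conv_nth)
  have dist: "distinct vs"
    using len ne by (simp add: distinct_conv_nth)
  have "0 < intersection_number x y" if "x \<in> set vs" "y \<in> set vs" "x \<noteq> y" for x y
  proof -
    have "x \<noteq> - y"
      using that ne len by (metis in_set_conv_nth)
    then have "det2 x y \<noteq> 0"
      using primitive_det2_eq_0 prim that by blast
    then show ?thesis
      using int_intersection_number[of x y] by linarith
  qed
  then have "48 \<le> crossing_sum (set vs) (set vs)"
    using dist len prim by (intro crossing_sum_ge_48) (auto simp: distinct_card pairwise_def)
  then show ?thesis
    by (simp add: crossing_sum_set[OF dist])
qed

theorem lemma4p5:
  fixes w1 w2 w3 w4 w5 w6 :: "int \<times> int"
  assumes "w1 = (1, 0)" and "w2 = (0, 1)" and "w3 = (1, 1)"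
    and "w4 = (-1, 1)" and "w5 = (2, 1)" and "w6 = (1, 2)"
  shows "minimal_system 6 [w1, w2, w3, w4, w5, w6] \<and>
    min_crossing_number 6 = crossing_number [w1, w2, w3, w4, w5, w6] \<and>
    crossing_number [w1, w2, w3, w4, w5, w6] = 24"
proof -
  let ?ws = "[w1, w2, w3, w4, w5, w6]"
  have all6: "(\<forall>i<6. P i) \<longleftrightarrow> P 0 \<and> P 1 \<and> P 2 \<and> P 3 \<and> P 4 \<and> P 5" for P :: "nat \<Rightarrow> bool"
    by (simp add: numeral_eq_Suc All_less_Suc2)
  have sys: "curve_system 6 ?ws"
    unfolding curve_system_def all6 using assms by (simp add: primitive_def)
  \<comment> \<open>The six curves form classes of size 2, 2, 2, one of the distributions where the
    lower bound is exactly 24.\<close>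
  have cr: "crossing_number ?ws = 24"
    using assms by (simp add: crossing_number_def intersection_number_def lessThan_Suc)
  have "min_crossing_number 6 = 24"
    unfolding min_crossing_number_def
    using sys cr crossing_number_6_ge_24 by (intro Least_equality) auto
  then show ?thesis
    using sys cr by (simp add: minimal_system_def)
qed

end
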